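(* For each pair of positive integers $n,m$ there is a unique increasing sequence of positive integers $\{a_i\}_{i=0}^\infty$ (divided into consecutive bins of sizes alternating $n,m,n,m,\ldots$) such that every positive integer has a unique $(n,m)$-bin legal decomposition using summands from this sequence.
   Context: Fix positive integers $n,m$. The terms $a_0<a_1<a_2<\cdots$ of an increasing sequence of positive integers are divided, in order, into consecutive bins whose sizes alternate $n,m,n,m,\ldots$: the first bin is $\{a_0,\ldots,a_{n-1}\}$, the second is $\{a_n,\ldots,a_{n+m-1}\}$, the third is $\{a_{n+m},\ldots,a_{n+m+n-1}\}$, and so on. Two bins are adjacent if they are consecutive in this ordering. An $(n,m)$-bin legal decomposition of an integer is an expression of it as a sum of terms of the sequence in which no two summands are from the same bin or from adjacent bins. Decompositions are identified up to the order of the summands. *)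

theory Defs
  imports Main "HOL-Library.Multiset"
begin

definition bin_size :: "nat \<Rightarrow> nat \<Rightarrow> nat \<Rightarrow> nat" where
  "bin_size n m k = (if even k then n else m)"

definition bin_start :: "nat \<Rightarrow> nat \<Rightarrow> nat \<Rightarrow> nat" where
  "bin_start n m k = (\<Sum>j<k. bin_size n m j)"

(* Bins are numbered from 0. *)
definition bin :: "nat \<Rightarrow> nat \<Rightarrow> (nat \<Rightarrow> nat) \<Rightarrow> nat \<Rightarrow> nat set" where
  "bin n m a k = a ` {bin_start n m k ..< bin_start n m (Suc k)}"

(* A decomposition is the multiset of its summands, since the order is irrelevant.
   In "legal_decomposition", the sub-multiset {#x, y#} ranges over pairs of distinct
   occurrences of summands, so x = y is possible exactly when x is a repeated summand. *)
definition legal_decomposition ::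
  "nat \<Rightarrow> nat \<Rightarrow> (nat \<Rightarrow> nat) \<Rightarrow> nat \<Rightarrow> nat multiset \<Rightarrow> bool" where
  "legal_decomposition n m a N D \<longleftrightarrow>
     set_mset D \<subseteq> range a \<and>
     sum_mset D = N \<and>
     (\<forall>x y k l. {#x, y#} \<subseteq># D \<and> x \<in> bin n m a k \<and> y \<in> bin n m a l \<longrightarrow>
        k \<noteq> l \<and> k \<noteq> Suc l \<and> l \<noteq> Suc k)"

end

theory Submission
  imports Defs
begin

text \<open>
  Let \<open>F i\<close> be the number of legal index sets contained in \<open>{..<i}\<close>. A legal set with largest
  element \<open>i\<close> is \<open>insert i S\<close> for a legal \<open>S\<close> below the start \<open>s i\<close> of the bin that precedes the bin
  of \<open>i\<close>, so \<open>F (Suc i) = F i + F (s i)\<close>. For the sequence \<open>a = F\<close> it follows by induction that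
  summation maps the legal subsets of \<open>{..<i}\<close> bijectively onto \<open>{..<F i}\<close>: those containing \<open>i\<close>
  cover exactly the next block \<open>{F i..<F i + F (s i)}\<close>.

  Conversely, if two sequences with the property first differ at \<open>i\<close>, with \<open>a i < b i\<close>, then the
  decomposition of \<open>a i\<close> over \<open>b\<close> uses only terms before \<open>b i\<close>, so it is also a decomposition of
  \<open>a i\<close> over \<open>a\<close>, and it is different from \<open>a i\<close> itself.
\<close>

section \<open>Separated index sets and their sums\<close>

text \<open>This abstracts legality from the bins: with \<open>s i\<close> the start of the bin
  preceding that of \<open>i\<close>, it rules out two indices in the same or in adjacent bins. What
  the counting arguments use about \<open>s\<close> is \<open>s i \<le> i\<close>.\<close>

definition separated :: "(nat \<Rightarrow> nat) \<Rightarrow> nat set \<Rightarrow> bool" where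
  "separated s S \<longleftrightarrow> (\<forall>i\<in>S. \<forall>j\<in>S. j < i \<longrightarrow> j < s i)"

lemma separated_empty [simp]: "separated s {}"
  by (simp add: separated_def)

lemma separated_singleton [simp]: "separated s {i}"
  by (simp add: separated_def)

lemma separated_subset: "separated s S \<Longrightarrow> T \<subseteq> S \<Longrightarrow> separated s T"
  by (auto simp: separated_def)

lemma separated_insert_top:
  assumes "S \<subseteq> {..<i}"
  shows "separated s (insert i S) \<longleftrightarrow> separated s S \<and> S \<subseteq> {..<s i}"
  using assms by (fastforce simp: separated_def)

text \<open>The value \<open>min i (s i)\<close> only serves termination; it is \<open>s i\<close> whenever \<open>s i \<le> i\<close>.\<close>

fun count_separated :: "(nat \<Rightarrow> nat) \<Rightarrow> nat \<Rightarrow> nat" where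
  "count_separated s 0 = 1"
| "count_separated s (Suc i) = count_separated s i + count_separated s (min i (s i))"

lemma count_separated_pos [simp]: "count_separated s i > 0"
  by (induction i) auto

lemma strict_mono_count_separated: "strict_mono (count_separated s)"
  by (simp add: strict_mono_Suc_iff)

text \<open>Removing a top index \<open>i\<close> leaves a separated set below \<open>s i\<close>,
  so the sum stays under \<open>count_separated s i + count_separated s (s i)\<close>, which is the
  next term. The induction is strong because it descends to \<open>s i\<close>.\<close>

lemma separated_sum_less:
  assumes "\<And>i. s i \<le> i" "separated s S" "S \<subseteq> {..<k}"
  shows "sum (count_separated s) S < count_separated s k"
  using assms(2,3)
proof (induction k arbitrary: S rule: less_induct)
  case (less k)
  show ?case
  proof (cases k)
    case 0
    with less.prems show ?thesis by simp
  next
    case (Suc i)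
    show ?thesis
    proof (cases "i \<in> S")
      case True
      define T where "T = S - {i}"
      have S: "S = insert i T" "i \<notin> T" "finite T" "T \<subseteq> {..<i}"
        using True less.prems(2) Suc finite_subset[of S "{..<k}"]
        by (auto simp: T_def less_Suc_eq)
      have "separated s T" "T \<subseteq> {..<s i}"
        using less.prems(1) S separated_insert_top[of T i s] by auto
      then have "sum (count_separated s) T < count_separated s (s i)"
        using less.IH[of "s i" T] assms(1)[of i] Suc by simp
      then show ?thesis
        using S assms(1)[of i] Suc by (simp add: min_absorb2)
    next
      case False
      then have "S \<subseteq> {..<i}"
        using less.prems(2) Suc by (auto simp: less_Suc_eq)
      then have "sum (count_separated s) S < count_separated s i"
        using less.IH[of i S] less.prems(1) Suc by simp
      then show ?thesis
        using Suc by simp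
    qed
  qed
qed

text \<open>Greedy choice: if \<open>N\<close> reaches the term at \<open>i\<close>, take
  \<open>i\<close>; the recurrence then bounds the remainder by the term at \<open>s i\<close>, so
  its summands lie below \<open>s i\<close> and remain separated from \<open>i\<close>.\<close>

lemma separated_sum_exists:
  assumes "\<And>i. s i \<le> i" "N < count_separated s k"
  shows "\<exists>S. separated s S \<and> S \<subseteq> {..<k} \<and> sum (count_separated s) S = N"
  using assms(2)
proof (induction k arbitrary: N rule: less_induct)
  case (less k)
  show ?case
  proof (cases k)
    case 0
    with less.prems show ?thesis by (intro exI[of _ "{}"]) simp
  next
    case (Suc i)
    show ?thesis
    proof (cases "N < count_separated s i")
      case True
      then obtain S where "separated s S" "S \<subseteq> {..<i}" "sum (count_separated s) S = N"
        using less.IH[of i N] Suc by auto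
      then show ?thesis
        using Suc by (intro exI[of _ S]) auto
    next
      case False
      have "N - count_separated s i < count_separated s (s i)"
        using False less.prems Suc assms(1)[of i] by (simp add: min_absorb2)
      then obtain S where S: "separated s S" "S \<subseteq> {..<s i}"
          "sum (count_separated s) S = N - count_separated s i"
        using less.IH[of "s i"] assms(1)[of i] Suc by auto
      have Si: "S \<subseteq> {..<i}"
        using S(2) assms(1)[of i] by auto
      have "sum (count_separated s) (insert i S) = N"
        using S(3) Si False finite_subset[OF Si] by (subst sum.insert) auto
      moreover have "separated s (insert i S)"
        using S Si by (simp add: separated_insert_top)
      ultimately show ?thesis
        using Si Suc by (intro exI[of _ "insert i S"]) auto
    qed
  qed
qed

text \<open>The sum alone decides whether the top index occurs, since a separated set without it
  falls short of that term. Both sets thus agree at the top, which can be stripped off.\<close>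

lemma separated_sum_inject:
  assumes "\<And>i. s i \<le> i"
    and "separated s S" "S \<subseteq> {..<k}" "separated s T" "T \<subseteq> {..<k}"
    and "sum (count_separated s) S = sum (count_separated s) T"
  shows "S = T"
  using assms(2-)
proof (induction k arbitrary: S T)
  case 0
  then show ?case by simp
next
  case (Suc k)
  have fin: "finite S" "finite T"
    using Suc.prems finite_subset by blast+
  have top_iff: "k \<in> U \<longleftrightarrow> sum (count_separated s) U \<ge> count_separated s k"
    if "separated s U" "U \<subseteq> {..<Suc k}" for U
  proof
    assume "k \<in> U"
    then show "sum (count_separated s) U \<ge> count_separated s k"
      using that(2) finite_subset[of U "{..<Suc k}"] by (intro member_le_sum) auto
  next
    assume "sum (count_separated s) U \<ge> count_separated s k"
    then have "\<not> U \<subseteq> {..<k}"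
      using separated_sum_less[OF assms(1) that(1), of k] by auto
    then show "k \<in> U"
      using that(2) by (auto simp: less_Suc_eq)
  qed
  have mem: "k \<in> S \<longleftrightarrow> k \<in> T"
    using top_iff Suc.prems by simp
  have "S - {k} = T - {k}"
  proof (rule Suc.IH)
    show "separated s (S - {k})" "separated s (T - {k})"
      using Suc.prems separated_subset by blast+
    show "S - {k} \<subseteq> {..<k}" "T - {k} \<subseteq> {..<k}"
      using Suc.prems by (auto simp: less_Suc_eq)
    show "sum (count_separated s) (S - {k}) = sum (count_separated s) (T - {k})"
      using Suc.prems fin mem by (auto simp: sum_diff1_nat)
  qed
  then show ?case
    using mem by blast
qed

lemma ex1_separated_sum:
  assumes "\<And>i. s i \<le> i"
  shows "\<exists>!S. finite S \<and> separated s S \<and> sum (count_separated s) S = N"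
proof -
  \<comment> \<open>A strictly increasing sequence of naturals dominates its index.\<close>
  have "N < count_separated s (Suc N)"
    using strict_mono_imp_increasing[OF strict_mono_count_separated, of "Suc N" s] by simp
  then obtain S where "separated s S" "S \<subseteq> {..<Suc N}" "sum (count_separated s) S = N"
    using separated_sum_exists[OF assms] by blast
  then show ?thesis
  proof (intro ex1I[of _ S] conjI)
    show "finite S"
      using \<open>S \<subseteq> {..<Suc N}\<close> finite_subset by blast
    fix T assume T: "finite T \<and> separated s T \<and> sum (count_separated s) T = N"
    with \<open>finite S\<close> have "finite (S \<union> T)"
      by simp
    \<comment> \<open>The competitor \<open>T\<close> is not known to lie below
      \<open>Suc N\<close>, so a common bound for both sets is chosen.\<close>
    then obtain k where "S \<union> T \<subseteq> {..<k}"
      by (metis bounded_nat_set_is_finite finite_nat_set_iff_bounded lessThan_iff subsetI)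
    then show "T = S"
      using T \<open>separated s S\<close> \<open>sum (count_separated s) S = N\<close>
      by (intro separated_sum_inject[OF assms, of T k S]) auto
  qed
qed

section \<open>Existence and uniqueness of the sequence\<close>

definition unique_sums :: "(nat \<Rightarrow> nat) \<Rightarrow> (nat \<Rightarrow> nat) \<Rightarrow> bool" where
  "unique_sums s a \<longleftrightarrow> (\<forall>N>0. \<exists>!S. finite S \<and> separated s S \<and> sum a S = N)"

lemma not_less_at_first_difference:
  fixes a b :: "nat \<Rightarrow> nat"
  assumes "strict_mono b" "\<And>j. a j > 0"
    and "unique_sums s a" "unique_sums s b"
    and eq: "\<And>j. j < i \<Longrightarrow> a j = b j"
  shows "\<not> a i < b i"
proof
  assume less: "a i < b i"
  obtain S where S: "finite S" "separated s S" "sum b S = a i"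
    using assms(2)[of i] assms(4) unfolding unique_sums_def by blast
  have below: "j < i" if "j \<in> S" for j
  proof -
    have "b j \<le> sum b S"
      using that S(1) by (simp add: member_le_sum)
    with S(3) less have "b j < b i"
      by simp
    then show "j < i"
      by (simp add: strict_mono_less[OF assms(1)])
  qed
  have "sum a S = a i"
    using S(3) below eq by (metis sum.cong)
  moreover have "finite {i} \<and> separated s {i} \<and> sum a {i} = a i"
    by simp
  \<comment> \<open>Positivity of \<open>a i\<close> makes the uniqueness over \<open>a\<close>
    applicable.\<close>
  ultimately have "S = {i}"
    using S assms(2)[of i] assms(3) unfolding unique_sums_def by blast
  with below show False
    by auto
qed

lemma ex1_unique_sums:
  assumes "\<And>i. s i \<le> i"
  shows "\<exists>!a. strict_mono a \<and> (\<forall>i. a i > 0) \<and> unique_sums s a"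
proof (rule ex_ex1I)
  show "\<exists>a. strict_mono a \<and> (\<forall>i. a i > 0) \<and> unique_sums s a"
    using strict_mono_count_separated ex1_separated_sum[OF assms]
    by (intro exI[of _ "count_separated s"]) (simp add: unique_sums_def)
next
  fix a b
  assume a: "strict_mono a \<and> (\<forall>i. a i > 0) \<and> unique_sums s a"
    and b: "strict_mono b \<and> (\<forall>i. b i > 0) \<and> unique_sums s b"
  have "a i = b i" for i
  proof (induction i rule: less_induct)
    case (less i)
    have "\<not> a i < b i"
      using a b less.IH by (intro not_less_at_first_difference[of b a s]) auto
    moreover have "\<not> b i < a i"
      using a b less.IH by (intro not_less_at_first_difference[of a b s]) auto
    ultimately show ?case
      by simp
  qed
  then show "a = b" ..
qed

section \<open>Bins and the indices they contain\<close>

definition bin_index :: "nat \<Rightarrow> nat \<Rightarrow> nat \<Rightarrow> nat" where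
  "bin_index n m i = (LEAST k. i < bin_start n m (Suc k))"

text \<open>For indices \<open>i\<close> in bin 0 the truncated subtraction gives the value 0, which excludes any other
  index below \<open>i\<close>, as it should.\<close>

definition prev_bin_start :: "nat \<Rightarrow> nat \<Rightarrow> nat \<Rightarrow> nat" where
  "prev_bin_start n m i = bin_start n m (bin_index n m i - 1)"

context
  fixes n m :: nat
  assumes pos: "n > 0" "m > 0"
begin

lemma strict_mono_bin_start: "strict_mono (bin_start n m)"
  using pos by (simp add: strict_mono_Suc_iff bin_start_def bin_size_def)

text \<open>This adjunction between \<open>bin_index\<close> and \<open>bin_start\<close> reduces
  questions about bins to comparisons of bin numbers.\<close>

lemma bin_index_less_iff: "bin_index n m i < k \<longleftrightarrow> i < bin_start n m k"
proof
  \<comment> \<open>This witness shows that the \<open>LEAST\<close> in \<open>bin_index\<close> is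
    attained.\<close>
  have "i < bin_start n m (Suc i)"
    using strict_mono_imp_increasing[OF strict_mono_bin_start, of "Suc i"] by simp
  then have "i < bin_start n m (Suc (bin_index n m i))"
    unfolding bin_index_def by (rule LeastI)
  also assume "bin_index n m i < k"
  then have "bin_start n m (Suc (bin_index n m i)) \<le> bin_start n m k"
    by (simp add: strict_mono_less_eq[OF strict_mono_bin_start])
  finally show "i < bin_start n m k" .
next
  assume i: "i < bin_start n m k"
  then obtain k' where "k = Suc k'"
    by (cases k) (auto simp: bin_start_def)
  with i show "bin_index n m i < k"
    by (auto simp: bin_index_def less_Suc_eq_le intro: Least_le)
qed

lemma in_bin_iff:
  assumes "inj a"
  shows "a i \<in> bin n m a k \<longleftrightarrow> bin_index n m i = k"
proof -
  have "a i \<in> bin n m a k \<longleftrightarrow> \<not> i < bin_start n m k \<and> i < bin_start n m (Suc k)"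
    using assms by (auto simp: bin_def inj_image_mem_iff)
  then show ?thesis
    by (auto simp flip: bin_index_less_iff)
qed

lemma bin_index_mono: "j \<le> i \<Longrightarrow> bin_index n m j \<le> bin_index n m i"
  using bin_index_less_iff[of i "Suc (bin_index n m i)"]
    bin_index_less_iff[of j "Suc (bin_index n m i)"] by simp

lemma prev_bin_start_le: "prev_bin_start n m i \<le> i"
proof (rule ccontr)
  assume "\<not> prev_bin_start n m i \<le> i"
  then have "bin_index n m i < bin_index n m i - 1"
    by (simp add: prev_bin_start_def bin_index_less_iff)
  then show False
    by simp
qed

text \<open>Through this equivalence, separation for \<open>prev_bin_start\<close> becomes a gap of
  at least two between bin numbers.\<close>

lemma less_prev_bin_start_iff:
  "j < prev_bin_start n m i \<longleftrightarrow> Suc (bin_index n m j) < bin_index n m i"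
  unfolding prev_bin_start_def bin_index_less_iff[symmetric] by linarith

section \<open>Legal decompositions as separated index sets\<close>

text \<open>A repeated summand would form a pair within one bin, so a legal multiset is a set, and
  injectivity of \<open>a\<close> turns it into a set of indices.\<close>

lemma legal_decomposition_iff:
  assumes "strict_mono a"
  shows "legal_decomposition n m a N D \<longleftrightarrow>
    (\<exists>S. finite S \<and> separated (prev_bin_start n m) S \<and> sum a S = N \<and> D = mset_set (a ` S))"
proof -
  have inj: "inj a"
    using assms by (rule strict_mono_imp_inj_on)
  show ?thesis
  proof
    assume D: "legal_decomposition n m a N D"
    define S where "S = a -` set_mset D"
    have image: "a ` S = set_mset D"
      using D by (auto simp: S_def legal_decomposition_def)
    \<comment> \<open>For \<open>j < i\<close> monotonicity of \<open>bin_index\<close> excludes the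
      third case of the definition, so these two inequalities already force a gap of two.\<close>
    have far: "bin_index n m i \<noteq> bin_index n m j" "bin_index n m i \<noteq> Suc (bin_index n m j)"
      if "{#a i, a j#} \<subseteq># D" for i j
      using D that in_bin_iff[OF inj] unfolding legal_decomposition_def by blast+
    have "count D x = 1" if "x \<in># D" for x
    proof (rule ccontr)
      assume "count D x \<noteq> 1"
      with that have "count D x \<ge> 2"
        by (metis One_nat_def Suc_1 Suc_leI count_greater_eq_one_iff le_neq_implies_less)
      then have "{#x, x#} \<subseteq># D"
        by (auto simp: subseteq_mset_def)
      moreover obtain i where "x = a i"
        using \<open>x \<in># D\<close> image by blast
      ultimately show False
        using far(1)[of i i] by simp
    qed
    then have D_eq: "D = mset_set (a ` S)"
      unfolding image by (intro multiset_eqI) (metis count_mset_set(1) count_mset_set(3) finite_set_mset not_in_iff)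
    have "separated (prev_bin_start n m) S"
      unfolding separated_def less_prev_bin_start_iff
    proof (intro ballI impI)
      fix i j assume ij: "i \<in> S" "j \<in> S" "j < i"
      then have "a i \<noteq> a j"
        using inj by (auto dest: injD)
      with ij have "{#a i, a j#} \<subseteq># D"
        by (auto simp: S_def insert_subset_eq_iff in_diff_count)
      then show "Suc (bin_index n m j) < bin_index n m i"
        using far[of i j] bin_index_mono[of j i] ij by linarith
    qed
    moreover have "finite S"
      unfolding S_def by (intro finite_vimageI inj) simp
    moreover have "sum a S = N"
    proof -
      have "sum a S = sum id (a ` S)"
        using inj by (subst sum.reindex) (auto intro: inj_on_subset)
      also have "\<dots> = sum_mset D"
        by (subst D_eq) (simp add: sum_unfold_sum_mset)
      finally show ?thesis
        using D by (simp add: legal_decomposition_def)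
    qed
    ultimately show "\<exists>S. finite S \<and> separated (prev_bin_start n m) S \<and> sum a S = N \<and>
        D = mset_set (a ` S)"
      using D_eq by blast
  next
    assume "\<exists>S. finite S \<and> separated (prev_bin_start n m) S \<and> sum a S = N \<and> D = mset_set (a ` S)"
    then obtain S where S: "finite S" "separated (prev_bin_start n m) S" "sum a S = N"
      and D: "D = mset_set (a ` S)"
      by blast
    have "sum_mset D = sum id (a ` S)"
      by (simp add: D sum_unfold_sum_mset)
    also have "\<dots> = N"
      using inj S(3) by (subst sum.reindex) (auto intro: inj_on_subset)
    finally have "sum_mset D = N" .
    moreover have "k \<noteq> l \<and> k \<noteq> Suc l \<and> l \<noteq> Suc k"
      if xy: "{#x, y#} \<subseteq># D" "x \<in> bin n m a k" "y \<in> bin n m a l" for x y k l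
    proof -
      have "x \<in># D" "y \<in># D"
        using xy(1) by (auto dest: mset_subset_eqD)
      then obtain i j where ij: "i \<in> S" "j \<in> S" "x = a i" "y = a j"
        using S(1) D by auto
      \<comment> \<open>Equal entries of the pair would need multiplicity two, but
        \<open>mset_set\<close> gives at most one.\<close>
      have "x \<noteq> y"
      proof
        assume "x = y"
        then have "count D x \<ge> 2"
          using mset_subset_eq_count[OF xy(1), of x] by simp
        then show False
          by (simp add: D count_mset_set' split: if_splits)
      qed
      then have "i < j \<or> j < i"
        using ij by (metis linorder_neqE_nat)
      moreover have "bin_index n m i = k" "bin_index n m j = l"
        using xy ij in_bin_iff[OF inj] by auto
      ultimately show ?thesis
        using S(2) ij unfolding separated_def less_prev_bin_start_iff by fastforce
    qed
    moreover have "set_mset D \<subseteq> range a"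
      using S(1) D by auto
    ultimately show "legal_decomposition n m a N D"
      unfolding legal_decomposition_def by blast
  qed
qed

text \<open>Legal decompositions are the images of separated index sets under a map that is
  injective on them, and unique existence transfers along such a map.\<close>

lemma ex1_legal_decomposition_iff:
  assumes "strict_mono a"
  shows "(\<exists>!D. legal_decomposition n m a N D) \<longleftrightarrow>
    (\<exists>!S. finite S \<and> separated (prev_bin_start n m) S \<and> sum a S = N)"
proof -
  have inj: "inj a"
    using assms by (rule strict_mono_imp_inj_on)
  have inj_on: "inj_on (\<lambda>S. mset_set (a ` S))
      {S. finite S \<and> separated (prev_bin_start n m) S \<and> sum a S = N}"
  proof (rule inj_onI)
    fix S T
    assume "S \<in> {S. finite S \<and> separated (prev_bin_start n m) S \<and> sum a S = N}"
      and "T \<in> {S. finite S \<and> separated (prev_bin_start n m) S \<and> sum a S = N}"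
      and "mset_set (a ` S) = mset_set (a ` T)"
    then have "a ` S = a ` T"
      by (simp add: mset_set_eq_iff)
    then show "S = T"
      by (simp add: inj_image_eq_iff[OF inj])
  qed
  have "(\<exists>!y. \<exists>x. P x \<and> y = f x) \<longleftrightarrow> (\<exists>!x. P x)"
    if "inj_on f {x. P x}" for P :: "nat set \<Rightarrow> bool" and f :: "nat set \<Rightarrow> nat multiset"
    using that unfolding inj_on_def by blast
  from this[OF inj_on] show ?thesis
    unfolding legal_decomposition_iff[OF assms] by (simp add: conj_assoc)
qed

end

theorem proposition1p1:
  fixes n m :: nat
  assumes "n > 0" and "m > 0"
  shows "\<exists>!a :: nat \<Rightarrow> nat.
           strict_mono a \<and> (\<forall>i. a i > 0) \<and>
           (\<forall>N>0. \<exists>!D. legal_decomposition n m a N D)"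
proof -
  \<comment> \<open>The two uniqueness conditions are compared only for strictly increasing
    \<open>a\<close>; for any other \<open>a\<close> both conjunctions fail.\<close>
  have "strict_mono a \<and> (\<forall>i. a i > 0) \<and> (\<forall>N>0. \<exists>!D. legal_decomposition n m a N D) \<longleftrightarrow>
      strict_mono a \<and> (\<forall>i. a i > 0) \<and> unique_sums (prev_bin_start n m) a" for a
    using ex1_legal_decomposition_iff[OF assms, of a]
    by (cases "strict_mono a") (simp_all add: unique_sums_def)
  then show ?thesis
    using ex1_unique_sums[OF prev_bin_start_le[OF assms]] by simp
qed

end
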